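(* Let $V$ be a set of $n$ fat objects in $\mathbb{R}^d$ for a constant $d$. Then the intersection graph $G$ of $V$ has a 2-hop spanner with $O(n^{3/2})$ edges.
   Context: The intersection graph of a family of sets has one vertex per set and an (unweighted) edge between two distinct sets iff they have nonempty intersection. For a simple graph $G=(V,E)$, a $t$-hop spanner is a spanning subgraph $G'=(V,E')$, $E'\subseteq E$, with $d_{G'}(x,y)\le t\cdot d_G(x,y)$ for all $x,y\in V$, where $d_G$ is the shortest-path (hop) distance. A family of objects in $\mathbb{R}^d$ is fat if for every axis-aligned hypercube $\gamma$ with side length $\ell$, there exist $O(1)$ points (i.e., at most some constant number $c$ of points, $c$ independent of $n$ and $\gamma$) hitting all objects of the family that intersect $\gamma$ and have diameter at least $\ell$; a set of points hits an object if the object contains at least one of the points. The constant in the $O(\cdot)$ bound may depend on $d$ and on the fatness constant. *)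

theory Defs
  imports "HOL-Analysis.Analysis" "HOL-Library.Extended_Nat"
begin

text \<open>A simple graph is given by its vertex set and its set of edges, each edge being a
  two-element set of vertices.\<close>

definition intersection_edges :: "'a set set \<Rightarrow> 'a set set set" where
  "intersection_edges V = {{A, B} | A B. A \<in> V \<and> B \<in> V \<and> A \<noteq> B \<and> A \<inter> B \<noteq> {}}"

text \<open>The relational power below says that there is a walk with exactly \<open>k\<close> edges from \<open>x\<close> to
  \<open>y\<close>; the infimum of the empty set, for vertices in different components, is \<open>\<infinity>\<close>.\<close>

definition hop_dist :: "'v set set \<Rightarrow> 'v \<Rightarrow> 'v \<Rightarrow> enat" where
  "hop_dist E x y = (INF k \<in> {k. (x, y) \<in> {(u, v). {u, v} \<in> E} ^^ k}. enat k)"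

definition hop_spanner :: "nat \<Rightarrow> 'v set \<Rightarrow> 'v set set \<Rightarrow> 'v set set \<Rightarrow> bool" where
  "hop_spanner t V E E' \<longleftrightarrow>
     E' \<subseteq> E \<and> (\<forall>x\<in>V. \<forall>y\<in>V. hop_dist E' x y \<le> enat t * hop_dist E x y)"

definition hypercube :: "real ^ 'd \<Rightarrow> real \<Rightarrow> (real ^ 'd) set" where
  "hypercube a l = cbox a (\<chi> i. a $ i + l)"

text \<open>The library's \<^const>\<open>diameter\<close> is meaningful only for bounded sets; an unbounded set has
  infinite diameter.\<close>

definition diameter_at_least :: "real \<Rightarrow> (real ^ 'd) set \<Rightarrow> bool" where
  "diameter_at_least l X \<longleftrightarrow> (bounded X \<longrightarrow> l \<le> diameter X)"

text \<open>Fatness with the constant \<open>c\<close> made explicit. The points need not lie in the hypercube.\<close>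

definition fat :: "nat \<Rightarrow> (real ^ 'd) set set \<Rightarrow> bool" where
  "fat c V \<longleftrightarrow>
     (\<forall>a l. l > 0 \<longrightarrow>
        (\<exists>P. finite P \<and> card P \<le> c \<and>
           (\<forall>X\<in>V. X \<inter> hypercube a l \<noteq> {} \<and> diameter_at_least l X \<longrightarrow> X \<inter> P \<noteq> {})))"

end

theory Submission
  imports Defs
begin

text \<open>The proof is a divide and conquer with two ingredients. First, all edges at objects that contain a
  given point can be handled with \<open>O(n powr (3/2))\<close> edges: these objects form a clique, which is split into
  \<open>\<surd>n\<close> groups of size \<open>\<surd>n\<close>; every group is kept complete, and every object is joined to one neighbour
  in each group. Second, there is a separator: choose a scale \<open>l\<close> at which some cube of side \<open>l\<close> meets at
  least \<open>x n\<close> objects of diameter less than \<open>l\<close>, while the analogous property fails at scale \<open>l / 2\<close>. All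
  neighbours of the objects found meet the cube scaled by 3, which is covered by \<open>K\<close> cubes of side
  \<open>l / 2\<close>, so either they are hit by one of \<open>O(1)\<close> points or they are among at most \<open>K x n\<close> small objects.
  This gives \<open>T(n) \<le> T(K x n) + T((1 - x) n) + O(n powr (3/2))\<close>. The two parts overlap, but since the exponent
  exceeds 1, the recursion still solves to \<open>O(n powr (3/2))\<close> for small \<open>x\<close>.\<close>

section \<open>From two-hop replacements of edges to spanners\<close>

definition two_hop :: "'v set set \<Rightarrow> 'v \<Rightarrow> 'v \<Rightarrow> bool" where
  "two_hop E x y \<longleftrightarrow> {x, y} \<in> E \<or> (\<exists>z. {x, z} \<in> E \<and> {z, y} \<in> E)"

lemma two_hop_mono: "two_hop E x y \<Longrightarrow> E \<subseteq> F \<Longrightarrow> two_hop F x y"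
  unfolding two_hop_def by blast

lemma two_hop_commute: "two_hop E x y \<longleftrightarrow> two_hop E y x"
  unfolding two_hop_def by (auto simp: insert_commute)

text \<open>Replacing the edges of a walk one at a time at most doubles its length, so the spanner
  condition only has to be checked on edges.\<close>

lemma hop_spannerI:
  assumes "E' \<subseteq> E" and two: "\<And>x y. {x, y} \<in> E \<Longrightarrow> two_hop E' x y"
  shows "hop_spanner 2 V E E'"
proof -
  let ?R = "{(u, v). {u, v} \<in> E}" and ?R' = "{(u, v). {u, v} \<in> E'}"
  have walk: "\<exists>j\<le>2*k. (x, y) \<in> ?R' ^^ j" if "(x, y) \<in> ?R ^^ k" for x y k
    using that
  proof (induction k arbitrary: y)
    case 0
    then show ?case by (intro exI[of _ 0]) auto
  next
    case (Suc k)
    then obtain z where "(x, z) \<in> ?R ^^ k" and zy: "{z, y} \<in> E"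
      by auto
    with Suc.IH obtain j where j: "j \<le> 2*k" "(x, z) \<in> ?R' ^^ j"
      by blast
    from two[OF zy] consider "{z, y} \<in> E'" | w where "{z, w} \<in> E'" "{w, y} \<in> E'"
      unfolding two_hop_def by blast
    then show ?case
    proof cases
      case 1
      with j have "(x, y) \<in> ?R' ^^ Suc j" by auto
      with j show ?thesis by (intro exI[of _ "Suc j"]) auto
    next
      case 2
      with j have "(x, y) \<in> ?R' ^^ Suc (Suc j)" by auto
      with j show ?thesis by (intro exI[of _ "Suc (Suc j)"]) auto
    qed
  qed
  have "hop_dist E' x y \<le> enat 2 * hop_dist E x y" for x y
  proof (cases "{k. (x, y) \<in> ?R ^^ k} = {}")
    case True
    then have "hop_dist E x y = \<infinity>"
      unfolding hop_dist_def by (simp add: top_enat_def)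
    then show ?thesis by simp
  next
    case False
    \<comment> \<open>\<open>enat\<close> is well-ordered, so this infimum is attained by the length
      of an actual walk.\<close>
    then have "hop_dist E x y \<in> enat ` {k. (x, y) \<in> ?R ^^ k}"
      unfolding hop_dist_def by (metis (no_types, lifting) image_is_empty wellorder_InfI ex_in_conv)
    then obtain k where k: "hop_dist E x y = enat k" "(x, y) \<in> ?R ^^ k"
      by auto
    from walk[OF k(2)] obtain j where j: "j \<le> 2*k" "(x, y) \<in> ?R' ^^ j"
      by blast
    then have "hop_dist E' x y \<le> enat j"
      unfolding hop_dist_def by (intro INF_lower) auto
    with j k show ?thesis
      by (metis enat_ord_simps(1) order_trans times_enat_simps(1))
  qed
  with assms(1) show ?thesis
    unfolding hop_spanner_def by blast
qed

lemma intersection_edges_iff: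
  "{A, B} \<in> intersection_edges V \<longleftrightarrow> A \<in> V \<and> B \<in> V \<and> A \<noteq> B \<and> A \<inter> B \<noteq> {}"
  unfolding intersection_edges_def by (auto simp: doubleton_eq_iff)

lemma intersection_edges_mono: "U \<subseteq> V \<Longrightarrow> intersection_edges U \<subseteq> intersection_edges V"
  unfolding intersection_edges_def by blast

lemma intersection_edges_subset: "intersection_edges V \<subseteq> (\<lambda>(A, B). {A, B}) ` (V \<times> V)"
  unfolding intersection_edges_def by auto

lemma card_intersection_edges_le:
  assumes "finite V"
  shows "card (intersection_edges V) \<le> card V * card V"
  by (metis assms card_cartesian_product finite_cartesian_product intersection_edges_subset surj_card_le)

lemma fat_subset: "fat c V \<Longrightarrow> U \<subseteq> V \<Longrightarrow> fat c U"
  unfolding fat_def by (meson subsetD)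

section \<open>Edges at objects through given points\<close>

text \<open>If \<open>A\<close> contains \<open>p\<close> and meets \<open>B\<close>, the neighbour
  chosen for \<open>B\<close> in the group of \<open>A\<close> is either \<open>A\<close> itself or
  joined to \<open>A\<close> inside that group. The other endpoint \<open>B\<close> may be any
  object of \<open>V\<close>.\<close>

lemma two_hop_at_point_nat:
  fixes V :: "'a set set"
  assumes "finite V" and "card V \<le> s * s"
  shows "\<exists>E'. E' \<subseteq> intersection_edges V \<and> card E' \<le> 2 * card V * s \<and>
    (\<forall>A\<in>V. \<forall>B\<in>V. A \<noteq> B \<longrightarrow> A \<inter> B \<noteq> {} \<longrightarrow> p \<in> A \<longrightarrow> two_hop E' A B)"
proof -
  define L where "L = {A\<in>V. p \<in> A}"
  have finL: "finite L" and cardL: "card L \<le> card V"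
    using assms by (auto simp: L_def intro: card_mono)
  obtain h where h: "bij_betw h L {0..<card L}"
    using ex_bij_betw_finite_nat[OF finL] by blast
  have s: "h A div s < s" if "A \<in> L" for A
  proof -
    have "h A < card L" using h that by (auto simp: bij_betw_def)
    also have "\<dots> \<le> s * s" using cardL assms by simp
    finally show ?thesis by (simp add: less_mult_imp_div_less)
  qed
  have s0: "s > 0" if "A \<in> L" for A using s[OF that] by simp
  \<comment> \<open>Group \<open>i\<close> consists of the members \<open>A\<close> of the clique with \<open>h A div s = i\<close>.\<close>
  define E1 where "E1 = {{A, B} | A B. A \<in> L \<and> B \<in> L \<and> A \<noteq> B \<and> h A div s = h B div s}"
  define adj where "adj = (\<lambda>X i B. B \<in> L \<and> B \<noteq> X \<and> X \<inter> B \<noteq> {} \<and> h B div s = i)"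
  define ch where "ch = (\<lambda>X i. SOME B. adj X i B)"
  define E2 where "E2 = {{X, ch X i} | X i. X \<in> V \<and> i < s \<and> (\<exists>B. adj X i B)}"
  have ch: "adj X i (ch X i)" if "adj X i B" for X i B
    unfolding ch_def using that by (rule someI)
  \<comment> \<open>Both ends of an edge of \<open>E1\<close> have the same quotient by
    \<open>s\<close>, so one end and the remainder of the other determine the edge.\<close>
  have "E1 \<subseteq> (\<lambda>(A, r). {A, inv_into L h (h A div s * s + r)}) ` (L \<times> {..<s})"
  proof
    fix e assume "e \<in> E1"
    then obtain A B where e: "e = {A, B}" "A \<in> L" "B \<in> L" "h A div s = h B div s"
      unfolding E1_def by blast
    have "inv_into L h (h A div s * s + h B mod s) = B"
      using e h by (simp add: bij_betw_def inv_into_f_f)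
    then show "e \<in> (\<lambda>(A, r). {A, inv_into L h (h A div s * s + r)}) ` (L \<times> {..<s})"
      using e s0 by (intro image_eqI[of _ _ "(A, h B mod s)"]) auto
  qed
  then have "card E1 \<le> card (L \<times> {..<s})"
    using finL by (intro surj_card_le) auto
  then have c1: "card E1 \<le> card V * s"
    using cardL by (simp add: card_cartesian_product) (meson le_trans mult_le_mono1)
  have "E2 \<subseteq> (\<lambda>(X, i). {X, ch X i}) ` (V \<times> {..<s})"
    unfolding E2_def by auto
  then have "card E2 \<le> card (V \<times> {..<s})"
    using assms by (intro surj_card_le) auto
  then have c2: "card E2 \<le> card V * s"
    by (simp add: card_cartesian_product)
  have "card (E1 \<union> E2) \<le> 2 * card V * s"
    using c1 c2 card_Un_le[of E1 E2] by simp
  moreover have "E1 \<subseteq> intersection_edges V"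
    unfolding E1_def intersection_edges_def L_def by blast
  moreover have "E2 \<subseteq> intersection_edges V"
  proof
    fix e assume "e \<in> E2"
    then obtain X i where e: "e = {X, ch X i}" "X \<in> V" "adj X i (ch X i)"
      unfolding E2_def using ch by blast
    then show "e \<in> intersection_edges V"
      by (auto simp: intersection_edges_iff adj_def L_def)
  qed
  moreover have "two_hop (E1 \<union> E2) A B"
    if AB: "A \<in> V" "B \<in> V" "A \<noteq> B" "A \<inter> B \<noteq> {}" "p \<in> A" for A B
  proof -
    define i where "i = h A div s"
    have A: "A \<in> L" using AB by (simp add: L_def)
    have adj: "adj B i A" using AB A by (auto simp: adj_def i_def)
    have "{B, ch B i} \<in> E2"
      unfolding E2_def using adj AB s[OF A] i_def by blast
    moreover have "ch B i \<noteq> A \<Longrightarrow> {A, ch B i} \<in> E1"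
      unfolding E1_def using ch[OF adj] A by (auto simp: adj_def i_def)
    ultimately show ?thesis
      unfolding two_hop_def by (cases "ch B i = A") (auto simp: insert_commute)
  qed
  ultimately show ?thesis
    by (intro exI[of _ "E1 \<union> E2"]) auto
qed

lemma two_hop_at_point:
  fixes V :: "'a set set"
  assumes "finite V"
  shows "\<exists>E'. E' \<subseteq> intersection_edges V \<and> real (card E') \<le> 4 * real (card V) powr (3/2) \<and>
    (\<forall>A\<in>V. \<forall>B\<in>V. A \<noteq> B \<longrightarrow> A \<inter> B \<noteq> {} \<longrightarrow> p \<in> A \<longrightarrow> two_hop E' A B)"
proof (cases "V = {}")
  case True
  then show ?thesis by (intro exI[of _ "{}"]) auto
next
  case False
  define n where "n = card V"
  have n: "n \<ge> 1" using False assms by (simp add: n_def Suc_leI card_gt_0_iff)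
  \<comment> \<open>Rounding up gives \<open>n \<le> s * s\<close>; as \<open>n \<ge> 1\<close>, it
    costs at most a factor 2, so \<open>2 * n * s\<close> becomes the bound with constant 4.\<close>
  define s where "s = nat \<lceil>sqrt n\<rceil>"
  have "0 \<le> sqrt n" by simp
  then have "0 \<le> \<lceil>sqrt n\<rceil>" by linarith
  then have "real s = of_int \<lceil>sqrt n\<rceil>" by (simp add: s_def)
  then have s1: "sqrt n \<le> s" and "real s \<le> sqrt n + 1"
    by linarith+
  have "1 \<le> sqrt n" using n by simp
  with \<open>real s \<le> sqrt n + 1\<close> have s2: "real s \<le> 2 * sqrt n" by linarith
  have "real n = sqrt n * sqrt n" by simp
  also have "\<dots> \<le> real s * real s" using s1 by (intro mult_mono) auto
  finally have "n \<le> s * s" by (metis of_nat_le_iff of_nat_mult)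
  then obtain E' where E': "E' \<subseteq> intersection_edges V" "card E' \<le> 2 * n * s"
    "\<forall>A\<in>V. \<forall>B\<in>V. A \<noteq> B \<longrightarrow> A \<inter> B \<noteq> {} \<longrightarrow> p \<in> A \<longrightarrow> two_hop E' A B"
    using two_hop_at_point_nat[OF assms, of s p] unfolding n_def by blast
  have "real (card E') \<le> real (2 * n * s)" using E'(2) of_nat_le_iff by blast
  also have "\<dots> = 2 * real n * real s" by simp
  also have "\<dots> \<le> 2 * real n * (2 * sqrt n)" using s2 by (intro mult_left_mono) auto
  also have "\<dots> = 4 * (real n powr 1 * real n powr (1/2))"
    by (simp add: powr_half_sqrt)
  also have "\<dots> = 4 * real n powr (3/2)"
    by (simp only: powr_add[symmetric]) simp
  finally show ?thesis using E' n_def by blast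
qed

lemma two_hop_at_points:
  fixes V :: "'a set set"
  assumes "finite V" and "finite P"
  shows "\<exists>E'. E' \<subseteq> intersection_edges V \<and>
    real (card E') \<le> 4 * real (card P) * real (card V) powr (3/2) \<and>
    (\<forall>A\<in>V. \<forall>B\<in>V. A \<noteq> B \<longrightarrow> A \<inter> B \<noteq> {} \<longrightarrow> (A \<inter> P \<noteq> {} \<or> B \<inter> P \<noteq> {}) \<longrightarrow> two_hop E' A B)"
proof -
  obtain F where F: "\<And>p. F p \<subseteq> intersection_edges V"
    "\<And>p. real (card (F p)) \<le> 4 * real (card V) powr (3/2)"
    "\<And>p A B. A \<in> V \<Longrightarrow> B \<in> V \<Longrightarrow> A \<noteq> B \<Longrightarrow> A \<inter> B \<noteq> {} \<Longrightarrow> p \<in> A \<Longrightarrow> two_hop (F p) A B"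
    using two_hop_at_point[OF assms(1)] by metis
  have "real (card (\<Union>p\<in>P. F p)) \<le> real (\<Sum>p\<in>P. card (F p))"
    using card_UN_le[OF assms(2)] of_nat_le_iff by blast
  also have "\<dots> = (\<Sum>p\<in>P. real (card (F p)))" by simp
  also have "\<dots> \<le> (\<Sum>p\<in>P. 4 * real (card V) powr (3/2))"
    by (intro sum_mono F)
  finally have card: "real (card (\<Union>p\<in>P. F p)) \<le> 4 * real (card P) * real (card V) powr (3/2)"
    by simp
  have half: "two_hop (\<Union>p\<in>P. F p) A B"
    if "A \<in> V" "B \<in> V" "A \<noteq> B" "A \<inter> B \<noteq> {}" "A \<inter> P \<noteq> {}" for A B
  proof -
    from that obtain p where "p \<in> A" "p \<in> P" by blast
    then show ?thesis
      using F(3)[of A B p] that by (auto intro: two_hop_mono)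
  qed
  have "two_hop (\<Union>p\<in>P. F p) A B"
    if "A \<in> V" "B \<in> V" "A \<noteq> B" "A \<inter> B \<noteq> {}" "A \<inter> P \<noteq> {} \<or> B \<inter> P \<noteq> {}" for A B
    using that half[of A B] half[of B A] by (auto simp: two_hop_commute Int_commute)
  with card F(1) show ?thesis by (intro exI[of _ "\<Union>p\<in>P. F p"]) blast
qed

section \<open>Objects small compared with a cube\<close>

text \<open>Among the objects meeting the cube, these are the ones about which fatness at side
  \<open>l\<close> says nothing.\<close>

definition small_meeting :: "(real ^ 'd) set set \<Rightarrow> real ^ 'd \<Rightarrow> real \<Rightarrow> (real ^ 'd) set set" where
  "small_meeting V a l = {X\<in>V. X \<inter> hypercube a l \<noteq> {} \<and> \<not> diameter_at_least l X}"

lemma mem_hypercube: "x \<in> hypercube a l \<longleftrightarrow> (\<forall>i. a $ i \<le> x $ i \<and> x $ i \<le> a $ i + l)"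
  by (auto simp: hypercube_def mem_box_cart)

lemma dist_less_if_not_diameter_at_least:
  assumes "\<not> diameter_at_least l X" "x \<in> X" "y \<in> X"
  shows "dist x y < l"
  using assms diameter_bounded_bound[of X x y] by (auto simp: diameter_at_least_def)

lemma dist_hypercube_le:
  fixes x y :: "real ^ 'd"
  assumes "x \<in> hypercube a l" "y \<in> hypercube a l"
  shows "dist x y \<le> real CARD('d) * l"
proof -
  have "\<bar>(x - y) $ i\<bar> \<le> l" for i
  proof -
    have "a $ i \<le> x $ i" "x $ i \<le> a $ i + l" "a $ i \<le> y $ i" "y $ i \<le> a $ i + l"
      using assms by (auto simp: mem_hypercube)
    then show ?thesis by simp
  qed
  then have "(\<Sum>i\<in>UNIV. \<bar>(x - y) $ i\<bar>) \<le> (\<Sum>i\<in>(UNIV::'d set). l)"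
    by (intro sum_mono)
  then show ?thesis
    using norm_le_l1_cart[of "x - y"] by (simp add: dist_norm)
qed

text \<open>This stops the descent through the scales. Two small objects meeting the same tiny cube
  have all their points close together, whereas any two distinct nonempty sets contain two different
  points, and finitely many such pairs have a positive minimal distance.\<close>

lemma card_small_meeting_le_1:
  fixes V :: "(real ^ 'd) set set"
  assumes "finite V"
  shows "\<exists>e>0. \<forall>a l. l < e \<longrightarrow> card (small_meeting V a l) \<le> 1"
proof -
  define Q where "Q = {(X, Y). X \<in> V \<and> Y \<in> V \<and> X \<noteq> Y \<and> X \<noteq> {} \<and> Y \<noteq> {}}"
  have finQ: "finite Q"
    by (rule finite_subset[of _ "V \<times> V"]) (use assms in \<open>auto simp: Q_def\<close>)
  \<comment> \<open>Otherwise every point of one set would equal every point of the other, and both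
    would be the same singleton. Disjointness is not assumed.\<close>
  have "\<forall>q\<in>Q. \<exists>x y. x \<in> fst q \<and> y \<in> snd q \<and> x \<noteq> y"
  proof
    fix q assume q: "q \<in> Q"
    show "\<exists>x y. x \<in> fst q \<and> y \<in> snd q \<and> x \<noteq> y"
    proof (rule ccontr)
      assume "\<not> ?thesis"
      with q show False by (cases q) (fastforce simp: Q_def)
    qed
  qed
  then obtain f g where fg: "\<And>q. q \<in> Q \<Longrightarrow> f q \<in> fst q \<and> g q \<in> snd q \<and> f q \<noteq> g q"
    by metis
  \<comment> \<open>The extra 1 keeps \<open>D\<close> nonempty when there is no pair at all, so
    that \<open>Min D\<close> is meaningful.\<close>
  define D where "D = insert 1 ((\<lambda>q. dist (f q) (g q)) ` Q)"
  define m where "m = Min D"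
  have D: "finite D" "D \<noteq> {}" using finQ by (auto simp: D_def)
  have m0: "m > 0" unfolding m_def using D fg by (subst Min_gr_iff) (auto simp: D_def)
  have m: "m \<le> dist (f q) (g q)" if "q \<in> Q" for q
    unfolding m_def using D that by (intro Min_le) (auto simp: D_def)
  \<comment> \<open>A path from \<open>x\<close> to \<open>y\<close> through both objects and the
    cube costs less than \<open>l\<close> in each object and at most \<open>CARD('d) * l\<close>
    across the cube.\<close>
  define e where "e = m / (2 + real CARD('d))"
  have e0: "e > 0" using m0 by (simp add: e_def)
  have "card (small_meeting V a l) \<le> 1" if l: "l < e" for a l
  proof (rule ccontr)
    assume "\<not> ?thesis"
    then obtain X Y where XY: "X \<in> small_meeting V a l" "Y \<in> small_meeting V a l" "X \<noteq> Y"
      by (metis One_nat_def card_le_Suc0_iff_eq card.infinite zero_le)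
    then have q: "(X, Y) \<in> Q" by (auto simp: Q_def small_meeting_def)
    define x y where "x = f (X, Y)" and "y = g (X, Y)"
    from XY obtain u v where u: "u \<in> X" "u \<in> hypercube a l" and v: "v \<in> Y" "v \<in> hypercube a l"
      by (auto simp: small_meeting_def)
    have "x \<in> X" "y \<in> Y" using fg[OF q] by (auto simp: x_def y_def)
    then have "dist x u < l" "dist v y < l"
      using XY u v by (auto simp: small_meeting_def intro: dist_less_if_not_diameter_at_least)
    moreover have "dist u v \<le> real CARD('d) * l" using u v by (intro dist_hypercube_le)
    moreover have "dist x y \<le> dist x u + dist u v + dist v y"
      using dist_triangle[of x y u] dist_triangle[of u y v] by linarith
    ultimately have "dist x y < (2 + real CARD('d)) * l" by (simp add: algebra_simps)
    also have "\<dots> < (2 + real CARD('d)) * e" using l by (intro mult_strict_left_mono) auto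
    also have "\<dots> = m" by (simp add: e_def add_pos_nonneg)
    finally show False using m[OF q] by (simp add: x_def y_def)
  qed
  with e0 show ?thesis by blast
qed

text \<open>This gives the starting scale of the descent: a cube around the origin that contains one
  representative of each nonempty object.\<close>

lemma hypercube_meeting_all:
  fixes V :: "(real ^ 'd) set set"
  assumes "finite V"
  shows "\<exists>a l. l > 0 \<and> (\<forall>X\<in>V. X \<noteq> {} \<longrightarrow> X \<inter> hypercube a l \<noteq> {})"
proof -
  obtain r where r: "\<And>X. X \<noteq> {} \<Longrightarrow> r X \<in> (X :: (real ^ 'd) set)"
    by (metis ex_in_conv)
  have "bounded (r ` V)" using assms by (intro finite_imp_bounded) auto
  then obtain b where b: "b > 0" "\<And>x. x \<in> r ` V \<Longrightarrow> norm x \<le> b"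
    by (auto simp: bounded_pos)
  have "r X \<in> hypercube (\<chi> i. - b) (2 * b)" if "X \<in> V" for X
  proof -
    have "\<bar>r X $ i\<bar> \<le> b" for i
      using b(2)[of "r X"] that component_le_norm_cart[of "r X" i] by auto
    then show ?thesis by (auto simp: mem_hypercube abs_le_iff) (smt (verit))
  qed
  with r b(1) show ?thesis
    by (intro exI[of _ "\<chi> i. - b"] exI[of _ "2 * b"]) (auto simp: disjoint_iff)
qed

section \<open>Grid covers and the separator\<close>

lemma hypercube_grid_cover:
  fixes a :: "real ^ 'd"
  assumes "l > 0"
  shows "\<exists>S. finite S \<and> card S \<le> 7 ^ CARD('d) \<and>
    hypercube (a - (\<chi> i. l)) (3 * l) \<subseteq> (\<Union>b\<in>S. hypercube b (l / 2))"
proof -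
  \<comment> \<open>Six intervals of length \<open>l / 2\<close> already cover an edge of length
    \<open>3 * l\<close>; the seventh index takes the upper end, where \<open>t i = 6\<close> has
    floor 6.\<close>
  define F where "F = (PiE UNIV (\<lambda>_. {..<7}) :: ('d \<Rightarrow> nat) set)"
  define b where "b = (\<lambda>f :: 'd \<Rightarrow> nat. \<chi> i. a $ i - l + real (f i) * (l / 2))"
  have finF: "finite F" unfolding F_def by (intro finite_PiE) auto
  have "card F = 7 ^ CARD('d)" unfolding F_def by (simp add: card_PiE)
  then have "card (b ` F) \<le> 7 ^ CARD('d)"
    using card_image_le[OF finF, of b] by simp
  moreover have "hypercube (a - (\<chi> i. l)) (3 * l) \<subseteq> (\<Union>b\<in>b ` F. hypercube b (l / 2))"
  proof
    fix y assume y: "y \<in> hypercube (a - (\<chi> i. l)) (3 * l)"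
    define t where "t = (\<lambda>i. (y $ i - a $ i + l) / (l / 2))"
    define f where "f = (\<lambda>i. nat \<lfloor>t i\<rfloor>)"
    have t: "0 \<le> t i \<and> t i \<le> 6" for i
    proof -
      have "a $ i - l \<le> y $ i" "y $ i \<le> a $ i - l + 3 * l"
        using y by (auto simp: mem_hypercube)
      then show ?thesis using assms by (simp add: t_def field_simps)
    qed
    then have f: "real (f i) \<le> t i \<and> t i \<le> real (f i) + 1" for i
      unfolding f_def using t[of i] by linarith
    have "f i < 7" for i using f[of i] t[of i] by linarith
    then have "f \<in> F" by (auto simp: F_def PiE_def)
    moreover have "y \<in> hypercube (b f) (l / 2)"
      unfolding mem_hypercube
    proof
      fix i
      have yi: "y $ i = a $ i - l + t i * (l / 2)" using assms by (simp add: t_def field_simps)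
      have "real (f i) * (l / 2) \<le> t i * (l / 2)" "t i * (l / 2) \<le> (real (f i) + 1) * (l / 2)"
        using f[of i] assms by (auto intro!: mult_right_mono simp del: times_divide_eq_right)
      then show "b f $ i \<le> y $ i \<and> y $ i \<le> b f $ i + l / 2"
        unfolding yi b_def by (simp add: algebra_simps)
    qed
    ultimately show "y \<in> (\<Union>b\<in>b ` F. hypercube b (l / 2))" by blast
  qed
  ultimately show ?thesis using finF by (intro exI[of _ "b ` F"]) auto
qed

lemma fat_hitting_grid:
  fixes V :: "(real ^ 'd) set set"
  assumes "fat c V" "l > 0" "finite S"
  shows "\<exists>P. finite P \<and> card P \<le> card S * c \<and>
    (\<forall>X\<in>V. \<forall>b\<in>S. X \<inter> hypercube b l \<noteq> {} \<longrightarrow> diameter_at_least l X \<longrightarrow> X \<inter> P \<noteq> {})"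
proof -
  have "\<forall>b. \<exists>P. finite P \<and> card P \<le> c \<and>
      (\<forall>X\<in>V. X \<inter> hypercube b l \<noteq> {} \<and> diameter_at_least l X \<longrightarrow> X \<inter> P \<noteq> {})"
    using assms(1,2) unfolding fat_def by blast
  then obtain P where P: "\<And>b. finite (P b)" "\<And>b. card (P b) \<le> c"
      "\<And>b X. X \<in> V \<Longrightarrow> X \<inter> hypercube b l \<noteq> {} \<Longrightarrow> diameter_at_least l X \<Longrightarrow> X \<inter> P b \<noteq> {}"
    by metis
  have "card (\<Union>b\<in>S. P b) \<le> (\<Sum>b\<in>S. card (P b))" by (rule card_UN_le[OF assms(3)])
  also have "\<dots> \<le> card S * c" using sum_bounded_above[of S "\<lambda>b. card (P b)" c] P(2) by simp
  finally show ?thesis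
    using P(1,3) assms(3) by (intro exI[of _ "\<Union>b\<in>S. P b"]) blast
qed

text \<open>At the last scale where some cube meets at least \<open>q\<close> small objects, these
  objects \<open>M\<close> are removed to form \<open>V2\<close>. Every edge at \<open>M\<close> is
  hit by \<open>P\<close> or stays inside \<open>V1\<close>, which collects the fewer than
  \<open>q\<close> small objects of each half-size cube nearby. The \<open>max 0\<close> allows for
  \<open>V2 = {}\<close> when no such scale is found.\<close>

lemma fat_separator:
  fixes V :: "(real ^ 'd) set set"
  assumes "finite V" "fat c V" and q: "q > 1"
  defines "K \<equiv> 7 ^ CARD('d)"
  shows "\<exists>P V1 V2. finite P \<and> card P \<le> K * c \<and> V1 \<subseteq> V \<and> V2 \<subseteq> V \<and>
     real (card V1) \<le> real K * q \<and> real (card V2) \<le> max 0 (real (card V) - q) \<and>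
     (\<forall>A\<in>V. \<forall>B\<in>V. A \<inter> B \<noteq> {} \<longrightarrow>
        A \<inter> P \<noteq> {} \<or> B \<inter> P \<noteq> {} \<or> (A \<in> V1 \<and> B \<in> V1) \<or> (A \<in> V2 \<and> B \<in> V2))"
proof -
  have K1: "K \<ge> 1" by (simp add: K_def)
  obtain a0 l0 where l0: "l0 > 0" and a0: "\<And>X. X \<in> V \<Longrightarrow> X \<noteq> {} \<Longrightarrow> X \<inter> hypercube a0 l0 \<noteq> {}"
    using hypercube_meeting_all[OF assms(1)] by (elim exE conjE) (metis (full_types))
  define H where "H = (\<lambda>l. \<exists>a. q \<le> real (card (small_meeting V a l)))"
  show ?thesis
  proof (cases "H l0")
    case False
    \<comment> \<open>Every nonempty object meets this cube, so those missed by \<open>P\<close> are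
      small and fewer than \<open>q\<close>. They form \<open>V1\<close>, and \<open>V2\<close> is
      empty.\<close>
    obtain P where P: "finite P" "card P \<le> c"
      "\<forall>X\<in>V. X \<inter> hypercube a0 l0 \<noteq> {} \<and> diameter_at_least l0 X \<longrightarrow> X \<inter> P \<noteq> {}"
      using assms(2)[unfolded fat_def, rule_format, OF l0, of a0]
      by (elim exE conjE) (rule that; assumption)
    have "card P \<le> K * c" using P(2) K1 by (metis le_trans mult_le_mono1 nat_mult_1)
    moreover have "real (card (small_meeting V a0 l0)) \<le> real K * q"
    proof -
      have "real (card (small_meeting V a0 l0)) \<le> 1 * q"
        using False unfolding H_def by (metis linorder_le_cases mult_1)
      also have "\<dots> \<le> real K * q" using K1 q by (intro mult_right_mono) auto
      finally show ?thesis .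
    qed
    moreover have "A \<inter> P \<noteq> {} \<or> A \<in> small_meeting V a0 l0" if "A \<in> V" "A \<noteq> {}" for A
      using P(3) that a0[OF that] by (auto simp: small_meeting_def)
    ultimately show ?thesis
      using P(1) by (intro exI[of _ P] exI[of _ "small_meeting V a0 l0"] exI[of _ "{}"])
        (auto simp: small_meeting_def)
  next
    case True
    obtain e where e: "e > 0" "\<And>a l. l < e \<Longrightarrow> card (small_meeting V a l) \<le> 1"
      using card_small_meeting_le_1[OF assms(1)] by blast
    obtain N where N: "(1/2 :: real) ^ N < e / l0"
      using real_arch_pow_inv[of "e / l0" "1/2"] e l0 by auto
    have "l0 * (1/2) ^ N < e" using N l0 by (simp add: field_simps)
    \<comment> \<open>At this scale every cube meets at most one small object, which is below
      \<open>q > 1\<close>. As \<open>H\<close> holds at \<open>l0\<close>, it must be lost at some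
      halving before.\<close>
    then have "\<not> H (l0 * (1/2) ^ N)"
      using e(2)[of "l0 * (1/2) ^ N"] q unfolding H_def by (smt (verit) of_nat_le_1_iff)
    moreover have "H (l0 * (1/2) ^ j)" if "\<And>k. H (l0 * (1/2) ^ k) \<Longrightarrow> H (l0 * (1/2) ^ Suc k)" for j
      using True that by (induction j) (simp_all del: power_Suc)
    ultimately obtain k where k: "H (l0 * (1/2) ^ k)" "\<not> H (l0 * (1/2) ^ Suc k)"
      by blast
    define l where "l = l0 * (1/2) ^ k"
    have l: "l > 0" using l0 by (simp add: l_def)
    have half: "\<not> H (l / 2)" using k(2) by (simp add: l_def)
    from k(1) obtain a where a: "q \<le> real (card (small_meeting V a l))"
      unfolding H_def l_def by blast
    obtain S where S: "finite S" "card S \<le> K"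
      and cov: "hypercube (a - (\<chi> i. l)) (3 * l) \<subseteq> (\<Union>b\<in>S. hypercube b (l / 2))"
      using hypercube_grid_cover[OF l, of a] unfolding K_def by blast
    obtain P where P: "finite P" "card P \<le> card S * c"
      "\<forall>X\<in>V. \<forall>b\<in>S. X \<inter> hypercube b (l / 2) \<noteq> {} \<longrightarrow> diameter_at_least (l / 2) X \<longrightarrow> X \<inter> P \<noteq> {}"
      using fat_hitting_grid[OF assms(2) half_gt_zero[OF l] S(1)]
      by (elim exE conjE) (rule that; assumption)
    define V1 where "V1 = (\<Union>b\<in>S. small_meeting V b (l / 2))"
    define M where "M = small_meeting V a l"
    have MV: "M \<subseteq> V" by (auto simp: M_def small_meeting_def)
    have "real (card V1) \<le> real (\<Sum>b\<in>S. card (small_meeting V b (l / 2)))"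
      unfolding V1_def using card_UN_le[OF S(1)] of_nat_le_iff by blast
    also have "\<dots> = (\<Sum>b\<in>S. real (card (small_meeting V b (l / 2))))" by simp
    also have "\<dots> \<le> (\<Sum>b\<in>S. q)"
      using half unfolding H_def by (intro sum_mono) (metis linorder_le_cases)
    also have "\<dots> = real (card S) * q" by simp
    also have "\<dots> \<le> real K * q" using S(2) q by (intro mult_right_mono) auto
    finally have cV1: "real (card V1) \<le> real K * q" .
    have "card (V - M) = card V - card M" "card M \<le> card V"
      using MV assms(1) by (auto simp: card_Diff_subset finite_subset card_mono)
    then have cV2: "real (card (V - M)) \<le> real (card V) - q"
      using a by (simp add: M_def)
    \<comment> \<open>An object of \<open>M\<close> reaches less than \<open>l\<close> beyond the
      cube in each coordinate, so a point shared with \<open>B\<close> lies in some cube of the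
      cover. There \<open>B\<close> is either large and hit by \<open>P\<close>, or small and in
      \<open>V1\<close>.\<close>
    have near: "B \<inter> P \<noteq> {} \<or> B \<in> V1" if "A \<in> M" "B \<in> V" "A \<inter> B \<noteq> {}" for A B
    proof -
      from that obtain y where y: "y \<in> A" "y \<in> B" by blast
      from that obtain x where x: "x \<in> A" "x \<in> hypercube a l"
        by (auto simp: M_def small_meeting_def)
      have "dist y x < l"
        using that x y by (auto simp: M_def small_meeting_def intro: dist_less_if_not_diameter_at_least)
      then have "\<bar>y $ i - x $ i\<bar> < l" for i
        using component_le_norm_cart[of "y - x" i] by (simp add: dist_norm)
      then have "y \<in> hypercube (a - (\<chi> i. l)) (3 * l)"
        using x(2) unfolding mem_hypercube by (simp add: abs_less_iff) (smt (verit))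
      with cov obtain b where "b \<in> S" "y \<in> hypercube b (l / 2)" by blast
      with y that P(3) show ?thesis
        unfolding V1_def small_meeting_def by blast
    qed
    have "A \<inter> P \<noteq> {} \<or> B \<inter> P \<noteq> {} \<or> (A \<in> V1 \<and> B \<in> V1) \<or> (A \<in> V - M \<and> B \<in> V - M)"
      if "A \<in> V" "B \<in> V" "A \<inter> B \<noteq> {}" for A B
    proof (cases "A \<in> M \<or> B \<in> M")
      case True
      \<comment> \<open>Applying \<open>near\<close> to an object of \<open>M\<close> paired with
        itself puts that object, too, into \<open>V1\<close> unless \<open>P\<close> hits
        it.\<close>
      moreover have "A \<inter> A \<noteq> {}" "B \<inter> B \<noteq> {}" "B \<inter> A \<noteq> {}" using that by auto
      ultimately show ?thesis using near[of A A] near[of A B] near[of B A] near[of B B] that by blast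
    qed (use that in auto)
    moreover have "card P \<le> K * c" using P(2) S(2) by (meson le_trans mult_le_mono1)
    moreover have "V1 \<subseteq> V" by (auto simp: V1_def small_meeting_def)
    ultimately show ?thesis
      using P(1) cV1 cV2
      by (intro exI[of _ P] exI[of _ V1] exI[of _ "V - M"]) auto
  qed
qed

section \<open>Solving the recursion\<close>

text \<open>The choice of \<open>x\<close> makes \<open>(K x) powr (3/2) = x / 2\<close>, while \<open>(1 - x) powr (3/2) \<le> 1 - x\<close>: the
  recursion keeps a slack of \<open>x / 2\<close> times the main term to pay for the separator.\<close>

lemma two_hop_exists:
  fixes V :: "(real ^ 'd) set set"
  defines "K \<equiv> (7 :: real) ^ CARD('d)"
  defines "x \<equiv> 1 / (4 * K ^ 3)"
  assumes "finite V" "fat c V"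
  shows "\<exists>E'. E' \<subseteq> intersection_edges V \<and>
    (\<forall>A\<in>V. \<forall>B\<in>V. A \<noteq> B \<longrightarrow> A \<inter> B \<noteq> {} \<longrightarrow> two_hop E' A B) \<and>
    real (card E') \<le> (8 * K * real c + 1) / x * real (card V) powr (3/2)"
  using assms(3,4)
proof (induction "card V" arbitrary: V rule: less_induct)
  case less
  define n where "n = card V"
  \<comment> \<open>The term \<open>8 * K * real c\<close> lets the slack \<open>C * (x / 2)\<close>
    pay for the edges at \<open>P\<close>; the \<open>+ 1\<close> ensures
    \<open>C \<ge> 1 / x\<close> for the base case even if \<open>c = 0\<close>.\<close>
  define C where "C = (8 * K * real c + 1) / x"
  have K: "K \<ge> 1" by (simp add: K_def)
  then have x: "0 < x" by (simp add: x_def)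
  have K3: "K ^ 3 \<ge> K" using K power_increasing[of 1 3 K] by simp
  have Kx: "K * x \<le> 1 / 4" using K K3 by (simp add: x_def field_simps)
  have "1 * x \<le> K * x" using K x by (intro mult_right_mono) auto
  then have x1: "x \<le> 1 / 4" using Kx by simp
  have Cx: "4 * (K * real c) \<le> C * (x / 2)" using x by (simp add: C_def)
  have C0: "C \<ge> 0" using x K by (simp add: C_def)
  have split: "real n powr (3/2) = real n * sqrt n"
  proof (cases "n = 0")
    case False
    then have "real n * sqrt n = real n powr 1 * real n powr (1/2)" by (simp add: powr_half_sqrt)
    then show ?thesis by (simp only: powr_add[symmetric]) simp
  qed simp
  show ?case
  proof (cases "x * real n \<le> 1")
    case True
    \<comment> \<open>The separator requires \<open>x * real n > 1\<close>. Below that,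
      \<open>n\<close> is bounded by a constant and all edges can be kept.\<close>
    have "real (card (intersection_edges V)) \<le> real n * real n"
      using card_intersection_edges_le[OF less.prems(1)] n_def by (metis of_nat_le_iff of_nat_mult)
    also have "\<dots> = real n powr (3/2) * sqrt n" by (simp add: split)
    also have "\<dots> \<le> real n powr (3/2) * C"
    proof (intro mult_left_mono)
      have "real n \<le> real n * real n"
        by (metis le_square of_nat_le_iff of_nat_mult)
      then have "sqrt n \<le> sqrt (real n * real n)" by (rule real_sqrt_le_mono)
      also have "\<dots> = real n" by simp
      also have "\<dots> \<le> 1 / x" using True x by (simp add: field_simps)
      also have "\<dots> \<le> C" unfolding C_def using x K by (intro divide_right_mono) auto
      finally show "sqrt n \<le> C" .
    qed simp
    finally have "real (card (intersection_edges V)) \<le> C * real n powr (3/2)" by (simp add: mult.commute)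
    moreover have "\<forall>A\<in>V. \<forall>B\<in>V. A \<noteq> B \<longrightarrow> A \<inter> B \<noteq> {} \<longrightarrow> two_hop (intersection_edges V) A B"
      by (auto simp: two_hop_def intersection_edges_iff)
    ultimately show ?thesis unfolding C_def n_def by blast
  next
    case False
    then have n0: "0 < real n" by (metis mult_zero_right not_le less_eq_real_def of_nat_0_le_iff zero_le_one)
    obtain P V1 V2 where P: "finite P" "card P \<le> 7 ^ CARD('d) * c" and V12: "V1 \<subseteq> V" "V2 \<subseteq> V"
      and c1: "real (card V1) \<le> K * (x * real n)"
      and c2: "real (card V2) \<le> max 0 (real n - x * real n)"
      and sep: "\<And>A B. A \<in> V \<Longrightarrow> B \<in> V \<Longrightarrow> A \<inter> B \<noteq> {} \<Longrightarrow>
        A \<inter> P \<noteq> {} \<or> B \<inter> P \<noteq> {} \<or> (A \<in> V1 \<and> B \<in> V1) \<or> (A \<in> V2 \<and> B \<in> V2)"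
      using fat_separator[OF less.prems, of "x * real n"] False
      unfolding n_def[symmetric] K_def by auto
    have "x * real n \<le> 1 * real n" using x1 by (intro mult_right_mono) auto
    with c2 have c2: "real (card V2) \<le> (1 - x) * real n" by (simp add: algebra_simps)
    have "K * x * real n \<le> 1 / 4 * real n" using Kx by (intro mult_right_mono) auto
    then have "real (card V1) < real n" using c1 n0 by linarith
    then have "card V1 < card V" by (simp add: n_def)
    have "(1 - x) * real n < 1 * real n" using x n0 by (intro mult_strict_right_mono) auto
    then have "card V2 < card V" using c2 by (simp add: n_def)
    have sub12: "finite V1" "finite V2" "fat c V1" "fat c V2"
      using less.prems V12 by (auto intro: finite_subset fat_subset)
    obtain E1 where E1: "E1 \<subseteq> intersection_edges V1"
        "\<forall>A\<in>V1. \<forall>B\<in>V1. A \<noteq> B \<longrightarrow> A \<inter> B \<noteq> {} \<longrightarrow> two_hop E1 A B"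
        "real (card E1) \<le> C * real (card V1) powr (3/2)"
      using less.hyps[OF \<open>card V1 < card V\<close> sub12(1,3), folded C_def]
      by (elim exE conjE) (rule that; assumption)
    obtain E2 where E2: "E2 \<subseteq> intersection_edges V2"
        "\<forall>A\<in>V2. \<forall>B\<in>V2. A \<noteq> B \<longrightarrow> A \<inter> B \<noteq> {} \<longrightarrow> two_hop E2 A B"
        "real (card E2) \<le> C * real (card V2) powr (3/2)"
      using less.hyps[OF \<open>card V2 < card V\<close> sub12(2,4), folded C_def]
      by (elim exE conjE) (rule that; assumption)
    obtain E0 where E0: "E0 \<subseteq> intersection_edges V"
        "\<forall>A\<in>V. \<forall>B\<in>V. A \<noteq> B \<longrightarrow> A \<inter> B \<noteq> {} \<longrightarrow> (A \<inter> P \<noteq> {} \<or> B \<inter> P \<noteq> {}) \<longrightarrow> two_hop E0 A B"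
        "real (card E0) \<le> 4 * real (card P) * real n powr (3/2)"
      using two_hop_at_points[OF less.prems(1) P(1), folded n_def]
      by (elim exE conjE) (rule that; assumption)
    define E where "E = E0 \<union> (E1 \<union> E2)"
    have sub: "E \<subseteq> intersection_edges V"
      using E0(1) E1(1) E2(1) intersection_edges_mono[OF V12(1)] intersection_edges_mono[OF V12(2)]
      unfolding E_def by blast
    have hop: "two_hop E A B" if "A \<in> V" "B \<in> V" "A \<noteq> B" "A \<inter> B \<noteq> {}" for A B
    proof -
      have "two_hop E0 A B \<or> two_hop E1 A B \<or> two_hop E2 A B"
        using sep[of A B] E0(2) E1(2) E2(2) that by metis
      then show ?thesis unfolding E_def by (auto elim: two_hop_mono)
    qed
    have pw: "(t * real n) powr (3/2) = t powr (3/2) * real n powr (3/2)" if "t \<ge> 0" for t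
      using that by (simp add: powr_mult)
    have Kx2: "(K * x) powr (3/2) = x / 2"
    proof -
      \<comment> \<open>\<open>x\<close> was chosen to make \<open>K * x\<close> a square, so that
        its power \<open>3/2\<close> is the cube of \<open>1 / (2 * K)\<close>.\<close>
      have "K * x = (1 / (2 * K)) powr 2"
        using K by (simp add: x_def field_simps power2_eq_square power3_eq_cube)
      then have "(K * x) powr (3/2) = (1 / (2 * K)) powr 3" by (simp add: powr_powr)
      also have "\<dots> = (1 / (2 * K)) ^ 3" using K by (simp add: powr_numeral)
      also have "\<dots> = x / 2" by (simp add: x_def power_divide power_mult_distrib)
      finally show ?thesis .
    qed
    have "real (card V1) powr (3/2) \<le> (K * x * real n) powr (3/2)"
      using c1 by (intro powr_mono2) (auto simp: mult.assoc)
    also have "\<dots> = x / 2 * real n powr (3/2)"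
      using pw[of "K * x"] K x by (simp only: Kx2) simp
    finally have b1: "real (card V1) powr (3/2) \<le> x / 2 * real n powr (3/2)" .
    have "(1 - x) powr (3/2) \<le> (1 - x) powr 1" using x x1 by (intro powr_mono') auto
    then have b2': "(1 - x) powr (3/2) \<le> 1 - x" using x1 by simp
    have "real (card V2) powr (3/2) \<le> ((1 - x) * real n) powr (3/2)"
      using c2 by (intro powr_mono2) auto
    also have "\<dots> \<le> (1 - x) * real n powr (3/2)"
      using pw[of "1 - x"] b2' x1 by (simp add: mult_right_mono)
    finally have b2: "real (card V2) powr (3/2) \<le> (1 - x) * real n powr (3/2)" .
    have "real (card P) \<le> real (7 ^ CARD('d) * c)" using P(2) of_nat_le_iff by blast
    then have cP: "real (card P) \<le> K * real c" by (simp add: K_def)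
    have "card E \<le> card E0 + (card E1 + card E2)"
      unfolding E_def using card_Un_le[of E0 "E1 \<union> E2"] card_Un_le[of E1 E2] by linarith
    then have "real (card E) \<le> real (card E0) + (real (card E1) + real (card E2))" by linarith
    also have "\<dots> \<le> 4 * (K * real c) * real n powr (3/2)
        + (C * (x / 2 * real n powr (3/2)) + C * ((1 - x) * real n powr (3/2)))"
    proof (intro add_mono)
      show "real (card E0) \<le> 4 * (K * real c) * real n powr (3/2)"
        using cP by (intro order_trans[OF E0(3)] mult_right_mono) auto
    qed (use C0 b1 b2 in \<open>auto intro!: order_trans[OF E1(3)] order_trans[OF E2(3)] mult_left_mono
        simp del: times_divide_eq_left\<close>)
    also have "\<dots> \<le> C * (x / 2) * real n powr (3/2)
        + (C * (x / 2 * real n powr (3/2)) + C * ((1 - x) * real n powr (3/2)))"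
      by (intro add_right_mono mult_right_mono Cx powr_ge_zero)
    \<comment> \<open>The shares of the separator, \<open>V1\<close> and \<open>V2\<close> add up
      exactly: \<open>x / 2 + x / 2 + (1 - x) = 1\<close>.\<close>
    also have "\<dots> = C * real n powr (3/2)" by (simp add: algebra_simps)
    finally show ?thesis using sub hop unfolding C_def n_def by blast
  qed
qed

theorem theorem3p5:
  fixes c :: nat
  shows "\<exists>C::real. \<forall>(n::nat) (V :: (real ^ 'd) set set).
           finite V \<and> card V = n \<and> fat c V \<longrightarrow>
           (\<exists>E'. hop_spanner 2 V (intersection_edges V) E' \<and>
                 real (card E') \<le> C * real n powr (3/2))"
proof -
  define K where "K = (7 :: real) ^ CARD('d)"
  \<comment> \<open>This depends only on the dimension and on \<open>c\<close>, as it has to be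
    fixed before \<open>n\<close> and \<open>V\<close>.\<close>
  define C where "C = (8 * K * real c + 1) / (1 / (4 * K ^ 3))"
  have "\<exists>E'. hop_spanner 2 V (intersection_edges V) E' \<and> real (card E') \<le> C * real (card V) powr (3/2)"
    if V: "finite V" "fat c V" for V :: "(real ^ 'd) set set"
  proof -
    obtain E' where E': "E' \<subseteq> intersection_edges V"
      "\<forall>A\<in>V. \<forall>B\<in>V. A \<noteq> B \<longrightarrow> A \<inter> B \<noteq> {} \<longrightarrow> two_hop E' A B"
      "real (card E') \<le> C * real (card V) powr (3/2)"
      using two_hop_exists[OF V, folded K_def, folded C_def]
      by (elim exE conjE) (rule that; assumption)
    then show ?thesis
      by (intro exI[of _ E'] conjI hop_spannerI) (auto simp: intersection_edges_iff)
  qed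
  then show ?thesis by blast
qed

end
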